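(* The problem of profile factorisation — given a profile $\mathbf{p}\in\mathbf{P}$, find a divisor $\mathbf{d}$ of $\mathbf{p}$ (i.e. $\mathbf{p}=\mathbf{d}\times\mathbf{q}$ for some $\mathbf{q}\in\mathbf{P}$) with $\mathbf{d}\ne(1)$ and $\mathbf{d}\ne\mathbf{p}$, or answer that $\mathbf{p}$ is irreducible if no such divisor exists — is at least as hard as integer factorisation (integer factorisation reduces to it).
   Context: A profile is a sequence $\mathbf{p}=(p_i)_{i\in\mathbb{N}}$ of natural numbers for which there exists $h\ge -1$ with $p_i\ge 1$ for $0\le i\le h$ and $p_i=0$ for $i>h$ (the null sequence $(0)$ is a profile). $\mathbf{P}$ is the set of profiles, with elementwise sum and product $(\mathbf{p}\times\mathbf{q})_i = p_i\sum_{j=0}^i q_j + q_i\sum_{j=0}^i p_j - p_i q_i$; $(1)=(1,0,0,\ldots)$ is its multiplicative identity. Profiles are encoded as finite sequences of natural numbers in binary. Integer factorisation: given $n\in\mathbb{N}$, find a divisor $d$ of $n$ with $d\ne 1$, $d\ne n$, or report that none exists. *)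

theory Defs
  imports "HOL-Computational_Algebra.Polynomial"
begin

section \<open>Profiles\<close>

text \<open>In the following definition \<open>k\<close> is \<open>h + 1\<close>, so that \<open>h \<ge> -1\<close> becomes \<open>k \<ge> 0\<close>.\<close>

typedef profile =
  "{p :: nat \<Rightarrow> nat. \<exists>k. (\<forall>i<k. 1 \<le> p i) \<and> (\<forall>i\<ge>k. p i = 0)}"
  morphisms level Abs_profile
  by (rule exI[of _ "\<lambda>_. 0"]) auto

setup_lifting type_definition_profile

text \<open>The truncated subtraction on naturals below agrees with integer subtraction, since
  \<open>p i * q i\<close> is at most the second summand.\<close>

definition profile_mult :: "(nat \<Rightarrow> nat) \<Rightarrow> (nat \<Rightarrow> nat) \<Rightarrow> nat \<Rightarrow> nat" where
  "profile_mult p q i = p i * (\<Sum>j\<le>i. q j) + q i * (\<Sum>j\<le>i. p j) - p i * q i"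

lemma profile_mult_alt:
  "profile_mult p q i = p i * (\<Sum>j\<le>i. q j) + q i * (\<Sum>j<i. p j)"
proof -
  have "(\<Sum>j\<le>i. p j) = (\<Sum>j<i. p j) + p i"
    by (metis lessThan_Suc_atMost sum.lessThan_Suc)
  then show ?thesis
    by (simp add: profile_mult_def algebra_simps)
qed

lemma profile_mult_closed:
  assumes "\<exists>k. (\<forall>i<k. 1 \<le> p i) \<and> (\<forall>i\<ge>k. p i = 0)"
    and "\<exists>k. (\<forall>i<k. 1 \<le> q i) \<and> (\<forall>i\<ge>k. q i = 0)"
  shows "\<exists>k. (\<forall>i<k. 1 \<le> profile_mult p q i) \<and> (\<forall>i\<ge>k. profile_mult p q i = 0)"
proof -
  from assms obtain k l where
    k: "\<forall>i<k. 1 \<le> p i" "\<forall>i\<ge>k. p i = 0" and l: "\<forall>i<l. 1 \<le> q i" "\<forall>i\<ge>l. q i = 0"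
    by auto
  show ?thesis
  proof (cases "k = 0 \<or> l = 0")
    case True
    then have "profile_mult p q i = 0" for i
      using k l by (auto simp: profile_mult_def)
    then show ?thesis by auto
  next
    case False
    then have pos: "1 \<le> p 0" "1 \<le> q 0" using k l by auto
    have "1 \<le> profile_mult p q i" if "i < max k l" for i
    proof (cases "i < k")
      case True
      have "q 0 \<le> (\<Sum>j\<le>i. q j)" by (rule member_le_sum) auto
      then have "1 * 1 \<le> p i * (\<Sum>j\<le>i. q j)"
        using k True pos by (intro mult_le_mono) (blast intro: le_trans)+
      then show ?thesis unfolding profile_mult_alt by linarith
    next
      case False
      then have "i < l" "0 < i" using that \<open>\<not> (k = 0 \<or> l = 0)\<close> by auto
      have "p 0 \<le> (\<Sum>j<i. p j)" by (rule member_le_sum) (use \<open>0 < i\<close> in auto)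
      then have "1 * 1 \<le> q i * (\<Sum>j<i. p j)"
        using l \<open>i < l\<close> pos by (intro mult_le_mono) (blast intro: le_trans)+
      then show ?thesis unfolding profile_mult_alt by linarith
    qed
    moreover have "profile_mult p q i = 0" if "i \<ge> max k l" for i
      using that k l by (simp add: profile_mult_def)
    ultimately show ?thesis by blast
  qed
qed

lemma sum_profile_mult:
  "(\<Sum>j\<le>i. profile_mult p q j) = (\<Sum>j\<le>i. p j) * (\<Sum>j\<le>i. q j)"
  by (induction i) (simp_all add: profile_mult_alt lessThan_Suc_atMost algebra_simps)

lemma eq_if_sums_eq:
  fixes p q :: "nat \<Rightarrow> nat"
  assumes "\<And>i. (\<Sum>j\<le>i. p j) = (\<Sum>j\<le>i. q j)"
  shows "p = q"
proof
  fix i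
  show "p i = q i"
  proof (cases i)
    case 0
    then show ?thesis using assms[of 0] by simp
  next
    case (Suc n)
    then show ?thesis using assms[of n] assms[of i] by simp
  qed
qed

instantiation profile :: comm_semiring_1
begin

lift_definition zero_profile :: profile is "\<lambda>_. 0"
  by (rule exI[of _ 0]) auto

lift_definition one_profile :: profile is "\<lambda>i. if i = 0 then 1 else 0"
  by (rule exI[of _ 1]) auto

lift_definition plus_profile :: "profile \<Rightarrow> profile \<Rightarrow> profile" is "\<lambda>p q i. p i + q i"
proof -
  fix p q :: "nat \<Rightarrow> nat"
  assume "\<exists>k. (\<forall>i<k. 1 \<le> p i) \<and> (\<forall>i\<ge>k. p i = 0)"
    and "\<exists>k. (\<forall>i<k. 1 \<le> q i) \<and> (\<forall>i\<ge>k. q i = 0)"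
  then obtain k l where
    "\<forall>i<k. 1 \<le> p i" "\<forall>i\<ge>k. p i = 0" "\<forall>i<l. 1 \<le> q i" "\<forall>i\<ge>l. q i = 0"
    by auto
  then show "\<exists>k. (\<forall>i<k. 1 \<le> p i + q i) \<and> (\<forall>i\<ge>k. p i + q i = 0)"
    by (intro exI[of _ "max k l"]) (auto simp: less_max_iff_disj intro: trans_le_add1 trans_le_add2)
qed

lift_definition times_profile :: "profile \<Rightarrow> profile \<Rightarrow> profile" is profile_mult
  by (rule profile_mult_closed)

instance
proof
  fix a b c :: profile
  have one: "(\<Sum>j\<le>i. if j = 0 then 1 else 0) = (1::nat)" for i :: nat
    by simp
  show "a + b + c = a + (b + c)" by transfer (simp add: add.assoc)
  show "a + b = b + a" by transfer (simp add: add.commute)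
  show "0 + a = a" by transfer simp
  show "a * b * c = a * (b * c)"
    by transfer (rule eq_if_sums_eq, simp only: sum_profile_mult mult.assoc)
  show "a * b = b * a"
    by transfer (rule eq_if_sums_eq, simp only: sum_profile_mult mult.commute)
  show "1 * a = a"
    by transfer (rule eq_if_sums_eq, simp only: sum_profile_mult one mult_1)
  show "(a + b) * c = a * c + b * c"
    by transfer (rule eq_if_sums_eq,
        simp only: sum_profile_mult sum.distrib distrib_right)
  show "0 * a = 0" by transfer (simp add: profile_mult_def fun_eq_iff)
  show "a * 0 = 0" by transfer (simp add: profile_mult_def fun_eq_iff)
  show "(0::profile) \<noteq> 1" by transfer (simp add: fun_eq_iff)
qed

end

lemma level_add: "level (p + q) i = level p i + level q i"
  by (simp add: plus_profile.rep_eq)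

lemma level_one: "level 1 i = (if i = 0 then 1 else 0)"
  by transfer simp

lemma level_times:
  "level (p * q) i = level p i * (\<Sum>j\<le>i. level q j) + level q i * (\<Sum>j\<le>i. level p j)
     - level p i * level q i"
  by (simp add: times_profile.rep_eq profile_mult_def)


section \<open>Encodings\<close>

text \<open>\<open>Comma\<close> terminates an entry of a sequence, \<open>Absent\<close> is the code of the answer
  ``no such divisor exists'', and \<open>Work i\<close> are auxiliary tape symbols.\<close>

datatype symbol = Blank | Bit bool | Comma | Absent | Work nat

type_synonym word = "symbol list"

fun binary :: "nat \<Rightarrow> word" where
  "binary n =
    (if n < 2 then [Bit (n = 1)] else binary (n div 2) @ [Bit (odd n)])"

declare binary.simps [simp del]

text \<open>A profile is written as the sequence of its nonzero entries; the null profile is the empty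
  sequence.\<close>

definition profile_code :: "profile \<Rightarrow> word" where
  "profile_code p =
    concat (map (\<lambda>i. binary (level p i) @ [Comma]) [0..<LEAST k. level p k = 0])"

fun option_code :: "('a \<Rightarrow> word) \<Rightarrow> 'a option \<Rightarrow> word" where
  "option_code e None = [Absent]"
| "option_code e (Some x) = e x"


section \<open>Polynomial-time computability\<close>

datatype move = Move_Left | Stay | Move_Right

text \<open>Deterministic Turing machines with one tape that is infinite in both directions.\<close>

record tm =
  states :: "nat set"
  start :: nat
  final :: nat
  alphabet :: "symbol set"
  trans :: "nat \<Rightarrow> symbol \<Rightarrow> nat \<times> symbol \<times> move"

definition well_formed_tm :: "tm \<Rightarrow> bool" where
  "well_formed_tm M \<longleftrightarrow>
     finite (states M) \<and> start M \<in> states M \<and> final M \<in> states M \<and>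
     finite (alphabet M) \<and> Blank \<in> alphabet M \<and>
     (\<forall>q\<in>states M. \<forall>s\<in>alphabet M. trans M q s \<in> states M \<times> alphabet M \<times> UNIV)"

type_synonym config = "nat \<times> (int \<Rightarrow> symbol) \<times> int"

fun shift :: "move \<Rightarrow> int" where
  "shift Move_Left = -1"
| "shift Stay = 0"
| "shift Move_Right = 1"

fun step :: "tm \<Rightarrow> config \<Rightarrow> config" where
  "step M (q, t, h) =
    (if q = final M then (q, t, h)
     else case trans M q (t h) of (q', s, m) \<Rightarrow> (q', t(h := s), h + shift m))"

definition word_tape :: "word \<Rightarrow> int \<Rightarrow> symbol" where
  "word_tape w i = (if 0 \<le> i \<and> i < int (length w) then w ! nat i else Blank)"

text \<open>Since the final state is never left, \<open>n\<close> is an upper bound on the running time. The head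
  may halt anywhere, but the tape must hold nothing besides the output.\<close>

definition outputs_within :: "tm \<Rightarrow> word \<Rightarrow> nat \<Rightarrow> word \<Rightarrow> bool" where
  "outputs_within M w n v \<longleftrightarrow>
     (\<exists>h. (step M ^^ n) (start M, word_tape w, 0) = (final M, word_tape v, h))"

definition polytime_computable ::
  "('a \<Rightarrow> word) \<Rightarrow> ('b \<Rightarrow> word) \<Rightarrow> ('a \<Rightarrow> 'b) \<Rightarrow> bool" where
  "polytime_computable e e' f \<longleftrightarrow>
     (\<exists>M (b :: nat poly). well_formed_tm M \<and>
        (\<forall>x. set (e x) \<subseteq> alphabet M - {Blank} \<and>
             outputs_within M (e x) (poly b (length (e x))) (e' (f x))))"


section \<open>Search problems and reductions\<close>

record ('a, 'b) search_problem =
  instance_code :: "'a \<Rightarrow> word"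
  answer_code :: "'b \<Rightarrow> word"
  correct :: "'a \<Rightarrow> 'b \<Rightarrow> bool"

text \<open>Polynomial-time many-one reductions between search problems: \<open>f\<close> translates instances
  of \<open>A\<close> to instances of \<open>B\<close>, and \<open>g\<close> translates every correct answer back.\<close>

definition polytime_reducible ::
  "('a, 'b) search_problem \<Rightarrow> ('c, 'd) search_problem \<Rightarrow> bool" where
  "polytime_reducible A B \<longleftrightarrow>
     (\<exists>f g. polytime_computable (instance_code A) (instance_code B) f \<and>
            polytime_computable (answer_code B) (answer_code A) g \<and>
            (\<forall>x y. correct B (f x) y \<longrightarrow> correct A x (g y)))"

definition proper_divisor :: "'a::comm_semiring_1 \<Rightarrow> 'a \<Rightarrow> bool" where
  "proper_divisor d x \<longleftrightarrow> d dvd x \<and> d \<noteq> 1 \<and> d \<noteq> x"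

fun factorisation_answer :: "'a::comm_semiring_1 \<Rightarrow> 'a option \<Rightarrow> bool" where
  "factorisation_answer x (Some d) \<longleftrightarrow> proper_divisor d x"
| "factorisation_answer x None \<longleftrightarrow> \<not> (\<exists>d. proper_divisor d x)"

definition integer_factorisation :: "(nat, nat option) search_problem" where
  "integer_factorisation =
     \<lparr>instance_code = binary, answer_code = option_code binary, correct = factorisation_answer\<rparr>"

definition profile_factorisation :: "(profile, profile option) search_problem" where
  "profile_factorisation =
     \<lparr>instance_code = profile_code, answer_code = option_code profile_code,
      correct = factorisation_answer\<rparr>"

end

(* The one-level profile (n) has, for n >= 1, exactly the divisors (a) with a dvd n, because level i of
   d * q is at least level i of d times level 0 of q. So n is sent to (n), and an answer d is sent back
   to its level 0. Only 0 is exceptional: every profile divides the null profile, also those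
   with level 0 equal to 1, so that 0 is sent to (4) instead, whose only proper divisor is (2). *)

theory Submission imports Defs begin

section \<open>One-level profiles\<close>

lift_definition single_profile :: "nat \<Rightarrow> profile" is "\<lambda>n i. if i = 0 then n else 0"
proof -
  fix n :: nat
  show "\<exists>k::nat. (\<forall>i<k. 1 \<le> (if i = 0 then n else 0)) \<and> (\<forall>i\<ge>k. (if i = 0 then n else 0) = 0)"
    by (rule exI[of _ "if n = 0 then 0 else 1"]) auto
qed

lemma level_single_profile: "level (single_profile n) i = (if i = 0 then n else 0)"
  by transfer simp

lemma level_times_alt:
  "level (p * q) i = level p i * (\<Sum>j\<le>i. level q j) + level q i * (\<Sum>j<i. level p j)"
  by (simp add: times_profile.rep_eq profile_mult_alt)

lemma single_profile_inject [simp]: "single_profile m = single_profile n \<longleftrightarrow> m = n"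
  by (metis level_single_profile)

lemma single_profile_one: "single_profile 1 = 1"
  by transfer (simp add: fun_eq_iff)

lemma single_profile_times: "single_profile (m * n) = single_profile m * single_profile n"
  by (simp flip: level_inject add: fun_eq_iff level_times_alt level_single_profile)

lemma dvd_single_profileE:
  assumes "d dvd single_profile n" and "n > 0"
  obtains a where "d = single_profile a" and "a dvd n"
proof
  obtain q where q: "single_profile n = d * q"
    using assms(1) by (elim dvdE)
  have n: "n = level d 0 * level q 0"
    using arg_cong[OF q, of "\<lambda>p. level p 0"] by (simp add: level_times_alt level_single_profile)
  show "level d 0 dvd n"
    by (simp add: n)
  have "level d i = 0" if "i > 0" for i
  proof -
    \<comment> \<open>Level \<open>i\<close> of the product is 0 for \<open>i > 0\<close>, so both
      natural summands of \<open>level_times_alt\<close> vanish; the first one suffices.\<close>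
    have "level d i * (\<Sum>j\<le>i. level q j) = 0"
      using that arg_cong[OF q, of "\<lambda>p. level p i"]
      by (simp add: level_times_alt level_single_profile)
    moreover have "level q 0 \<le> (\<Sum>j\<le>i. level q j)"
      by (rule member_le_sum) auto
    \<comment> \<open>A factor of the positive \<open>n\<close> is positive. This makes the partial
      sum of \<open>q\<close> positive and forces \<open>level d i = 0\<close>.\<close>
    moreover have "level q 0 > 0"
      using n assms(2) by simp
    ultimately show ?thesis by (simp only: mult_eq_0_iff) linarith
  qed
  then show "d = single_profile (level d 0)"
    by (simp flip: level_inject add: fun_eq_iff level_single_profile)
qed

text \<open>Being an equivalence for arbitrary \<open>d\<close>, it transfers the answer that no
  proper divisor exists as well as a proper divisor itself.\<close>

lemma proper_divisor_single_profile_iff: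
  assumes "n > 0"
  shows "proper_divisor d (single_profile n) \<longleftrightarrow> (\<exists>a. d = single_profile a \<and> proper_divisor a n)"
proof
  assume d: "proper_divisor d (single_profile n)"
  then obtain a where a: "d = single_profile a" "a dvd n"
    using assms dvd_single_profileE unfolding proper_divisor_def by blast
  moreover have "a \<noteq> 1" "a \<noteq> n"
    using d a(1) single_profile_one unfolding proper_divisor_def by auto
  ultimately show "\<exists>a. d = single_profile a \<and> proper_divisor a n"
    unfolding proper_divisor_def by blast
next
  assume "\<exists>a. d = single_profile a \<and> proper_divisor a n"
  then obtain a where a: "d = single_profile a" "a dvd n" "a \<noteq> 1" "a \<noteq> n"
    unfolding proper_divisor_def by blast
  from a(2) obtain b where "n = a * b" ..
  then have "d dvd single_profile n"
    by (simp add: a(1) single_profile_times)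
  moreover have "d \<noteq> 1"
    unfolding single_profile_one[symmetric] a(1) using a(3) by simp
  ultimately show "proper_divisor d (single_profile n)"
    using a(1,4) by (simp add: proper_divisor_def)
qed

section \<open>The translations of instances and answers\<close>

definition factorisation_instance :: "nat \<Rightarrow> profile" where
  "factorisation_instance n = single_profile (if n = 0 then 4 else n)"

definition level_answer :: "profile option \<Rightarrow> nat option" where
  "level_answer = map_option (\<lambda>d. level d 0)"

lemma level_answer_correct:
  assumes "factorisation_answer (factorisation_instance n) y"
  shows "factorisation_answer n (level_answer y)"
proof (cases "n = 0")
  case True
  \<comment> \<open>This rules out the answer \<open>None\<close> for the profile (4).\<close>
  have "proper_divisor (2::nat) 4" by (simp add: proper_divisor_def)
  then have "proper_divisor (single_profile 2) (single_profile 4)"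
    by (subst proper_divisor_single_profile_iff) auto
  with assms True obtain d where y: "y = Some d" "proper_divisor d (single_profile 4)"
    by (cases y) (auto simp: factorisation_instance_def)
  then obtain a where "d = single_profile a" "proper_divisor a 4"
    by (auto simp: proper_divisor_single_profile_iff)
  \<comment> \<open>A proper divisor of 4 is neither 1 nor 0, since 0 does not divide 4; it is thus
    a proper divisor of 0.\<close>
  with y True show ?thesis
    by (auto simp: level_answer_def level_single_profile proper_divisor_def)
next
  case False
  with assms show ?thesis
    by (cases y) (auto simp: factorisation_instance_def level_answer_def level_single_profile
        proper_divisor_single_profile_iff)
qed


section \<open>Codes\<close>

lemma set_binary: "set (binary n) \<subseteq> range Bit"
proof (induction n rule: less_induct)
  case (less n)
  then show ?case by (subst binary.simps) auto
qed

lemma binary_neq_Nil: "binary n \<noteq> []"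
  by (subst binary.simps) auto

text \<open>Halving a positive number ends at 1, so there are no leading zeros. A machine can
  therefore recognise the exceptional input 0 by its first symbol.\<close>

lemma hd_binary: "hd (binary n) = Bit (n > 0)"
proof (induction n rule: less_induct)
  case (less n)
  show ?case
  proof (cases "n < 2")
    case True
    then show ?thesis by (subst binary.simps) auto
  next
    case False
    then show ?thesis
      using less[of "n div 2"] by (subst binary.simps) (simp add: binary_neq_Nil)
  qed
qed

lemma binary_zero: "binary 0 = [Bit False]"
  by (simp add: binary.simps)

lemma binary_four: "binary 4 = [Bit True, Bit False, Bit False]"
  by (simp add: binary.simps)

lemma profile_code_eq_Nil: "level p 0 = 0 \<Longrightarrow> profile_code p = []"
  by (simp add: profile_code_def Least_eq_0)

text \<open>Since \<open>binary\<close> contains only bits, the first \<open>Comma\<close> marks the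
  end of level 0; this is how the answer machine finds its output.\<close>

lemma profile_code_Comma:
  assumes "level p 0 > 0"
  obtains w where "profile_code p = binary (level p 0) @ Comma # w"
    and "set w \<subseteq> insert Comma (range Bit)"
proof
  define k where "k = (LEAST k. level p k = 0)"
  \<comment> \<open>The bound in the type definition of profiles supplies a witness, without which
    the \<open>LEAST\<close> in the code would be unspecified.\<close>
  have "\<exists>k. level p k = 0"
    using level[of p] by auto
  then have "level p k = 0"
    unfolding k_def by (rule LeastI_ex)
  with assms have "k > 0"
    by (cases k) auto
  then show "profile_code p = binary (level p 0) @
      Comma # concat (map (\<lambda>i. binary (level p i) @ [Comma]) [1..<k])"
    by (simp add: profile_code_def upt_conv_Cons flip: k_def)
  show "set (concat (map (\<lambda>i. binary (level p i) @ [Comma]) [1..<k])) \<subseteq> insert Comma (range Bit)"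
    by (auto dest: subsetD[OF set_binary])
qed

lemma profile_code_single:
  assumes "n > 0"
  shows "profile_code (single_profile n) = binary n @ [Comma]"
proof -
  have "(LEAST k. level (single_profile n) k = 0) = 1"
    using assms by (intro Least_equality) (auto simp: level_single_profile Suc_le_eq split: if_splits)
  then show ?thesis
    by (simp add: profile_code_def level_single_profile)
qed

text \<open>The first case also covers negative positions, where both sides are
  \<open>Blank\<close>.\<close>

lemma word_tape_append:
  "word_tape (u @ v) i = (if i < int (length u) then word_tape u i else word_tape v (i - int (length u)))"
  by (auto simp: word_tape_def nth_append nat_less_iff nat_diff_distrib')

lemma word_tape_Cons: "word_tape (s # w) i = (if i = 0 then s else word_tape w (i - 1))"
  by (auto simp: word_tape_def nth_Cons' nat_diff_distrib')

lemma word_tape_Nil: "word_tape [] i = Blank"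
  by (auto simp: word_tape_def)

lemma word_tape_in_set:
  assumes "0 \<le> i" and "i < int (length w)"
  shows "word_tape w i \<in> set w"
  using assms by (auto simp: word_tape_def)


section \<open>Turing machines\<close>

lemma funpow_step_final: "(step M ^^ n) (final M, t, h) = (final M, t, h)"
  by (induction n) simp_all

text \<open>The final state is absorbing, so surplus steps change nothing. Exact running times can
  thus be rounded up to a common polynomial bound.\<close>

lemma outputs_within_mono:
  assumes "outputs_within M w m v" and "m \<le> n"
  shows "outputs_within M w n v"
proof -
  obtain h where "(step M ^^ m) (start M, word_tape w, 0) = (final M, word_tape v, h)"
    using assms(1) by (auto simp: outputs_within_def)
  then have "(step M ^^ (n - m + m)) (start M, word_tape w, 0) = (final M, word_tape v, h)"
    by (simp only: funpow_add o_apply funpow_step_final)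
  with assms(2) show ?thesis
    by (auto simp: outputs_within_def)
qed

lemma scan_right:
  assumes "q \<noteq> final M"
    and "\<And>i. h \<le> i \<Longrightarrow> i < h + int k \<Longrightarrow> trans M q (t i) = (q, t i, Move_Right)"
  shows "(step M ^^ k) (q, t, h) = (q, t, h + int k)"
  using assms(2)
proof (induction k)
  case (Suc k)
  have "(step M ^^ k) (q, t, h) = (q, t, h + int k)"
    using Suc by auto
  moreover have "trans M q (t (h + int k)) = (q, t (h + int k), Move_Right)"
    using Suc.prems by auto
  ultimately show ?case
    using assms(1) by simp
qed simp

text \<open>The cells from the head onwards are not yet overwritten, so it suffices to know the
  transitions on the symbols of the initial tape \<open>t\<close>.\<close>

lemma erase_right:
  assumes "q \<noteq> final M"
    and "\<And>i. h \<le> i \<Longrightarrow> i < h + int k \<Longrightarrow> trans M q (t i) = (q, Blank, Move_Right)"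
  shows "(step M ^^ k) (q, t, h) =
    (q, \<lambda>i. if h \<le> i \<and> i < h + int k then Blank else t i, h + int k)"
  using assms(2)
proof (induction k)
  case 0
  then show ?case by (auto simp: fun_eq_iff)
next
  case (Suc k)
  have "(step M ^^ k) (q, t, h) =
      (q, \<lambda>i. if h \<le> i \<and> i < h + int k then Blank else t i, h + int k)"
    using Suc by auto
  moreover have "trans M q (t (h + int k)) = (q, Blank, Move_Right)"
    using Suc.prems by auto
  ultimately show ?case
    using assms(1) by (auto simp: fun_eq_iff)
qed

section \<open>The machines for the two translations\<close>

definition code_alphabet :: "symbol set" where
  "code_alphabet = {Blank, Bit False, Bit True, Comma, Absent}"

lemma Bit_in_code_alphabet: "Bit b \<in> code_alphabet"
  by (cases b) (simp_all add: code_alphabet_def)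

text \<open>State 1 appends \<open>Comma\<close>; states 2, 3, 4 complete the code of the profile \<open>(4)\<close>.\<close>

fun instance_trans :: "nat \<Rightarrow> symbol \<Rightarrow> nat \<times> symbol \<times> move" where
  "instance_trans q s =
    (if q = 0 then (if s = Bit False then (2, Bit True, Move_Right) else (1, s, Stay))
     else if q = 1 then (if s = Blank then (5, Comma, Stay) else (1, s, Move_Right))
     else if q = 2 then (3, Bit False, Move_Right)
     else if q = 3 then (4, Bit False, Move_Right)
     else (5, Comma, Stay))"

definition instance_tm :: tm where
  "instance_tm = \<lparr>states = {..5}, start = 0, final = 5, alphabet = code_alphabet,
     trans = instance_trans\<rparr>"

lemma well_formed_instance_tm: "well_formed_tm instance_tm"
  by (auto simp: well_formed_tm_def instance_tm_def code_alphabet_def)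

lemma instance_tm_zero: "outputs_within instance_tm (binary 0) 4 (profile_code (single_profile 4))"
proof -
  have funpow_4: "(f ^^ 4) x = f (f (f (f x)))" for f :: "config \<Rightarrow> config" and x
    by (simp add: numeral_eq_Suc)
  have "(step instance_tm ^^ 4) (0, word_tape (binary 0), 0) =
      (5, word_tape (profile_code (single_profile 4)), 3)"
    unfolding funpow_4
    by (auto simp: instance_tm_def binary_zero binary_four profile_code_single
        word_tape_Cons word_tape_Nil fun_eq_iff)
  then show ?thesis
    by (simp add: outputs_within_def instance_tm_def)
qed

text \<open>The bound counts one step to leave state 0, one step per bit and one step to write the
  \<open>Comma\<close>.\<close>

lemma instance_tm_pos:
  assumes "n > 0"
  shows "outputs_within instance_tm (binary n) (length (binary n) + 2)
    (profile_code (single_profile n))"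
proof -
  define w where "w = binary n"
  have w: "word_tape w 0 = Bit True"
    using hd_binary[of n] binary_neq_Nil[of n] assms by (simp add: w_def word_tape_def hd_conv_nth)
  \<comment> \<open>The head stays on the leading 1, so the scan in state 1 begins at position 0 and
    takes exactly \<open>length w\<close> steps.\<close>
  have "step instance_tm (0, word_tape w, 0) = (1, word_tape w, 0)"
    by (simp add: instance_tm_def w fun_upd_idem)
  moreover have "(step instance_tm ^^ length w) (1, word_tape w, 0) = (1, word_tape w, int (length w))"
  proof -
    have "word_tape w i \<noteq> Blank" if "0 \<le> i" "i < int (length w)" for i
      using set_binary word_tape_in_set[OF that] unfolding w_def by fastforce
    then show ?thesis
      using scan_right[of 1 instance_tm 0 "length w" "word_tape w"]
      by (simp add: instance_tm_def)
  qed
  moreover have "step instance_tm (1, word_tape w, int (length w)) =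
      (5, word_tape (w @ [Comma]), int (length w))"
  proof -
    have "word_tape w (int (length w)) = Blank"
      by (simp add: word_tape_def)
    moreover have "(word_tape w)(int (length w) := Comma) = word_tape (w @ [Comma])"
      by (auto simp: fun_eq_iff word_tape_append word_tape_Cons word_tape_Nil)
        (simp add: word_tape_def)
    ultimately show ?thesis
      by (simp add: instance_tm_def)
  qed
  ultimately have "(step instance_tm ^^ (1 + length w + 1)) (0, word_tape w, 0) =
      (5, word_tape (w @ [Comma]), int (length w))"
    by (simp only: funpow_add o_apply One_nat_def funpow.simps id_apply)
  then show ?thesis
    using assms by (simp add: outputs_within_def instance_tm_def w_def profile_code_single)
qed

lemma polytime_factorisation_instance:
  "polytime_computable binary profile_code factorisation_instance"
  unfolding polytime_computable_def
proof (intro exI conjI allI)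
  show "well_formed_tm instance_tm"
    by (rule well_formed_instance_tm)
next
  fix n
  show "set (binary n) \<subseteq> alphabet instance_tm - {Blank}"
    using set_binary[of n] Bit_in_code_alphabet by (auto simp: instance_tm_def)
  \<comment> \<open>This bound covers both the 4 steps for the input 0 and the
    \<open>length (binary n) + 2\<close> steps for a positive input.\<close>
  have "outputs_within instance_tm (binary n) (length (binary n) + 4)
      (profile_code (factorisation_instance n))"
  proof (cases "n = 0")
    case True
    show ?thesis
      by (rule outputs_within_mono[where m = 4])
        (use instance_tm_zero True in \<open>simp_all add: factorisation_instance_def\<close>)
  next
    case False
    show ?thesis
      by (rule outputs_within_mono[where m = "length (binary n) + 2"])
        (use instance_tm_pos[of n] False in \<open>simp_all add: factorisation_instance_def\<close>)
  qed
  then show "outputs_within instance_tm (binary n) (poly [:4, 1:] (length (binary n)))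
      (profile_code (factorisation_instance n))"
    by (simp add: add.commute)
qed

text \<open>State 1 erases everything from the first \<open>Comma\<close> on. State 0 reads \<open>Blank\<close> only on the empty
  input, the code of the null profile, whose level 0 is 0.\<close>

fun answer_trans :: "nat \<Rightarrow> symbol \<Rightarrow> nat \<times> symbol \<times> move" where
  "answer_trans q s =
    (if q = 0 then
       (if s = Blank then (2, Bit False, Stay)
        else if s = Absent then (2, Absent, Stay)
        else if s = Comma then (1, Blank, Move_Right)
        else (0, s, Move_Right))
     else if s = Blank then (2, Blank, Stay)
     else (1, Blank, Move_Right))"

definition answer_tm :: tm where
  "answer_tm = \<lparr>states = {..2}, start = 0, final = 2, alphabet = code_alphabet,
     trans = answer_trans\<rparr>"

lemma well_formed_answer_tm: "well_formed_tm answer_tm"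
  by (auto simp: well_formed_tm_def answer_tm_def code_alphabet_def)

lemma answer_tm_Absent: "outputs_within answer_tm [Absent] 1 [Absent]"
  by (auto simp: outputs_within_def answer_tm_def word_tape_Cons word_tape_Nil fun_eq_iff)

lemma answer_tm_Nil: "outputs_within answer_tm [] 1 [Bit False]"
  by (auto simp: outputs_within_def answer_tm_def word_tape_Cons word_tape_Nil fun_eq_iff)

text \<open>State 0 passes over \<open>u\<close>, which has no \<open>Comma\<close>; one step erases
  the separating \<open>Comma\<close>, state 1 erases \<open>v\<close>, and a last step reads the
  \<open>Blank\<close> behind it.\<close>

lemma answer_tm_Comma:
  assumes "set u \<subseteq> range Bit" and "set v \<subseteq> insert Comma (range Bit)"
  shows "outputs_within answer_tm (u @ Comma # v) (length (u @ Comma # v) + 1) u"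
proof -
  let ?w = "u @ Comma # v"
  let ?t = "(word_tape ?w)(int (length u) := Blank)"
  have "(step answer_tm ^^ length u) (0, word_tape ?w, 0) = (0, word_tape ?w, int (length u))"
  proof -
    have "word_tape ?w i \<in> range Bit" if "0 \<le> i" "i < int (length u)" for i
      using assms(1) word_tape_in_set[OF that] that by (auto simp: word_tape_append)
    then have "trans answer_tm 0 (word_tape ?w i) = (0, word_tape ?w i, Move_Right)"
      if "0 \<le> i" "i < int (length u)" for i
      using that by (fastforce simp: answer_tm_def)
    then show ?thesis
      using scan_right[of 0 answer_tm 0 "length u" "word_tape ?w"] by (simp add: answer_tm_def)
  qed
  moreover have "step answer_tm (0, word_tape ?w, int (length u)) = (1, ?t, int (length u) + 1)"
    by (simp add: answer_tm_def word_tape_append word_tape_Cons)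
  moreover have "(step answer_tm ^^ length v) (1, ?t, int (length u) + 1) =
      (1, word_tape u, int (length ?w))"
  proof -
    \<comment> \<open>State 1 halts at the first \<open>Blank\<close>, so it must not meet one
      before the end of \<open>v\<close>.\<close>
    have "?t i \<noteq> Blank" if "int (length u) + 1 \<le> i" "i < int (length u) + 1 + int (length v)" for i
    proof -
      have "?t i = word_tape v (i - int (length u) - 1)"
        using that by (simp add: word_tape_append word_tape_Cons)
      also have "\<dots> \<in> set v"
        using that by (intro word_tape_in_set) auto
      finally show ?thesis using assms(2) by auto
    qed
    then have "trans answer_tm 1 (?t i) = (1, Blank, Move_Right)"
      if "int (length u) + 1 \<le> i" "i < int (length u) + 1 + int (length v)" for i
      using that by (simp add: answer_tm_def)
    moreover have "(\<lambda>i. if int (length u) + 1 \<le> i \<and> i < int (length u) + 1 + int (length v)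
        then Blank else ?t i) = word_tape u"
      by (auto simp: fun_eq_iff word_tape_append word_tape_Cons) (auto simp: word_tape_def)
    ultimately show ?thesis
      using erase_right[of 1 answer_tm "int (length u) + 1" "length v" ?t]
      by (simp add: answer_tm_def add.assoc)
  qed
  moreover have "step answer_tm (1, word_tape u, int (length ?w)) =
      (2, word_tape u, int (length ?w))"
    by (auto simp: answer_tm_def word_tape_def fun_eq_iff)
  \<comment> \<open>\<open>funpow_add\<close> applies the right summand first, so the phases appear
    in reverse order.\<close>
  ultimately have "(step answer_tm ^^ (1 + length v + 1 + length u)) (0, word_tape ?w, 0) =
      (2, word_tape u, int (length ?w))"
    by (simp only: funpow_add o_apply One_nat_def funpow.simps id_apply)
  moreover have "length ?w + 1 = 1 + length v + 1 + length u"
    and "start answer_tm = 0" and "final answer_tm = 2"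
    by (simp_all add: answer_tm_def)
  ultimately show ?thesis
    by (simp only: outputs_within_def) blast
qed

lemma polytime_level_answer:
  "polytime_computable (option_code profile_code) (option_code binary) level_answer"
  unfolding polytime_computable_def
proof (intro exI conjI allI)
  show "well_formed_tm answer_tm"
    by (rule well_formed_answer_tm)
next
  fix y :: "profile option"
  let ?w = "option_code profile_code y"
  have "set ?w \<subseteq> alphabet answer_tm - {Blank} \<and>
    outputs_within answer_tm ?w (length ?w + 1) (option_code binary (level_answer y))"
  proof (cases y)
    case None
    then show ?thesis
      \<comment> \<open>The number 2 is the bound \<open>length ?w + 1\<close> for the one-symbol
        code of \<open>None\<close>.\<close>
      using outputs_within_mono[OF answer_tm_Absent, of "Suc (Suc 0)"]
      by (simp add: level_answer_def answer_tm_def code_alphabet_def)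
  next
    case (Some d)
    show ?thesis
    proof (cases "level d 0 = 0")
      case True
      then show ?thesis
        using Some answer_tm_Nil by (simp add: level_answer_def profile_code_eq_Nil binary_zero)
    next
      case False
      then obtain v where v: "profile_code d = binary (level d 0) @ Comma # v"
          "set v \<subseteq> insert Comma (range Bit)"
        using profile_code_Comma by auto
      have "insert Comma (range Bit) \<subseteq> alphabet answer_tm - {Blank}"
        using Bit_in_code_alphabet by (auto simp: answer_tm_def code_alphabet_def)
      then have "set ?w \<subseteq> alphabet answer_tm - {Blank}"
        using Some v set_binary[of "level d 0"] by auto
      moreover have "outputs_within answer_tm ?w (length ?w + 1) (binary (level d 0))"
        using answer_tm_Comma[OF set_binary v(2)] Some v(1) by simp
      ultimately show ?thesis
        using Some by (simp add: level_answer_def)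
    qed
  qed
  then show "set ?w \<subseteq> alphabet answer_tm - {Blank}"
    and "outputs_within answer_tm ?w (poly [:1, 1:] (length ?w)) (option_code binary (level_answer y))"
    by simp_all
qed

theorem theorem6: "polytime_reducible integer_factorisation profile_factorisation"
  unfolding polytime_reducible_def integer_factorisation_def profile_factorisation_def
  search_problem.select_convs
  using polytime_factorisation_instance polytime_level_answer level_answer_correct by blast

end
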